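(* Let $a,b:[0,\infty)\to\mathbb{R}$ be positive continuous functions, let $g:[0,\infty)\to\mathbb{R}$ be continuous and nonnegative, and let $x_0>0$. Suppose that $b$ is non-decreasing and that $B(\infty)<A(\infty)$. Then the solution $Y$ of $$\frac{dY_t}{dt}=a(t)\,b(Y_t+g(t)),\quad t>0,\qquad Y_0=x_0,$$ explodes in finite time, and the time of explosion of $Y$ is $t_e=A^{-1}\bigl(\overline{B}(\infty)\bigr)$.
   Context: $A(t)=\int_0^t a(s)\,ds$ for $t\ge0$, and $B(x)=\int_{x_0}^x\frac{ds}{b(s)}$ for $x\ge x_0$; $A(\infty),B(\infty)\in(0,\infty]$ are their limits at $\infty$. The solution $Y$ is a maximal solution, assigned the value $\infty$ from the moment it becomes infinite; its time of explosion is $\sup\{t\ge0:Y_t<\infty\}\in[0,\infty]$, and $Y$ explodes in finite time if this is a real number. Before explosion $Y$ is continuous and strictly increasing, and $Y^{-1}$, defined on $[x_0,\infty)$, denotes its inverse. The function $\overline{B}$ is defined for $y\ge x_0$ by $$\overline{B}(y)=\int_{x_0}^y\frac{ds}{b\bigl(s+g(Y^{-1}(s))\bigr)},$$ and $\overline{B}(\infty)$ is its limit as $y\to\infty$. *)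

theory Defs
  imports "HOL-Analysis.Analysis"
begin

definition A_fun :: "(real \<Rightarrow> real) \<Rightarrow> real \<Rightarrow> real" where
  "A_fun a t = integral {0..t} a"

definition B_fun :: "(real \<Rightarrow> real) \<Rightarrow> real \<Rightarrow> real \<Rightarrow> real" where
  "B_fun b x0 x = integral {x0..x} (\<lambda>s. 1 / b s)"

text \<open>The limit at infinity of a real function, as an element of the extended reals.\<close>

definition at_infty :: "(real \<Rightarrow> real) \<Rightarrow> ereal" where
  "at_infty f = Lim at_top (\<lambda>x. ereal (f x))"

text \<open>
  \<open>solves a b g x0 T y\<close>: the function \<open>y\<close> solves \<open>y' = a(t) b(y + g(t))\<close>, \<open>y(0) = x0\<close>, on the
  interval \<open>[0, T)\<close> with \<open>0 < T \<le> \<infinity>\<close>; the values of \<open>y\<close> elsewhere are irrelevant. Since \<open>b\<close> is a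
  function on \<open>[0, \<infinity>)\<close>, the argument \<open>y + g(t)\<close> has to be nonnegative for the equation to make sense.
\<close>

definition solves ::
  "(real \<Rightarrow> real) \<Rightarrow> (real \<Rightarrow> real) \<Rightarrow> (real \<Rightarrow> real) \<Rightarrow> real \<Rightarrow> ereal \<Rightarrow> (real \<Rightarrow> real) \<Rightarrow> bool" where
  "solves a b g x0 T y \<longleftrightarrow>
     0 < T \<and> y 0 = x0 \<and>
     continuous_on {t. 0 \<le> t \<and> ereal t < T} y \<and>
     (\<forall>t. 0 \<le> t \<and> ereal t < T \<longrightarrow> 0 \<le> y t + g t) \<and>
     (\<forall>t. 0 < t \<and> ereal t < T \<longrightarrow> (y has_real_derivative a t * b (y t + g t)) (at t))"

text \<open>
  \<open>Y\<close> is a maximal (that is, non-extendable) solution, defined on some \<open>[0, T)\<close>, and continued by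
  the value \<open>\<infinity>\<close> from time \<open>T\<close> on. Maximal solutions need not be unique, because \<open>b\<close> is only
  continuous and monotone. That \<open>Y\<close> tends to \<open>\<infinity>\<close> at a finite \<open>T\<close> is not required here; it is a
  consequence of non-extendability.
\<close>

definition maximal_solution ::
  "(real \<Rightarrow> real) \<Rightarrow> (real \<Rightarrow> real) \<Rightarrow> (real \<Rightarrow> real) \<Rightarrow> real \<Rightarrow> (real \<Rightarrow> ereal) \<Rightarrow> bool" where
  "maximal_solution a b g x0 Y \<longleftrightarrow>
     (\<exists>T y. solves a b g x0 T y \<and>
        \<not> (\<exists>T' z. T < T' \<and> solves a b g x0 T' z \<and> (\<forall>t. 0 \<le> t \<and> ereal t < T \<longrightarrow> z t = y t)) \<and>
        (\<forall>t\<ge>0. Y t = (if ereal t < T then ereal (y t) else \<infinity>)))"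

definition explosion_time :: "(real \<Rightarrow> ereal) \<Rightarrow> ereal" where
  "explosion_time Y = Sup (ereal ` {t. 0 \<le> t \<and> Y t < \<infinity>})"

definition explodes_in_finite_time :: "(real \<Rightarrow> ereal) \<Rightarrow> bool" where
  "explodes_in_finite_time Y \<longleftrightarrow> (\<exists>r. explosion_time Y = ereal r)"

definition Y_inv :: "(real \<Rightarrow> ereal) \<Rightarrow> real \<Rightarrow> real" where
  "Y_inv Y s = the_inv_into {t. 0 \<le> t \<and> Y t < \<infinity>} Y (ereal s)"

definition Bbar_fun ::
  "(real \<Rightarrow> real) \<Rightarrow> (real \<Rightarrow> real) \<Rightarrow> real \<Rightarrow> (real \<Rightarrow> ereal) \<Rightarrow> real \<Rightarrow> real" where
  "Bbar_fun b g x0 Y y = integral {x0..y} (\<lambda>s. 1 / b (s + g (Y_inv Y s)))"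

text \<open>
  The inverse of \<open>A\<close> takes an extended real argument, so that limits at infinity can be inserted
  without truncation; it is meaningful only on the range of \<open>A\<close> over \<open>[0, \<infinity>)\<close>.
\<close>

definition A_inv :: "(real \<Rightarrow> real) \<Rightarrow> ereal \<Rightarrow> real" where
  "A_inv a v = the_inv_into {0..} (\<lambda>t. ereal (A_fun a t)) v"

end

theory Submission
  imports Defs
begin

text \<open>
  Since \<open>b\<close> is monotone and \<open>g \<ge> 0\<close>, the derivative of \<open>B(y(t))\<close> is at least \<open>a(t)\<close>, so
  \<open>A(t) \<le> B(y(t)) \<le> B(\<infinity>) < A(\<infinity>)\<close> as long as the solution \<open>y\<close> lives, and its lifetime \<open>T\<close> is finite.
  A bounded \<open>y\<close> could be continued beyond \<open>T\<close>: as \<open>b\<close> is monotone, Picard iteration started at a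
  constant increases to a solution, so no compactness theorem is needed for local existence. Hence
  \<open>y(t) \<rightarrow> \<infinity>\<close> as \<open>t \<rightarrow> T\<close>. Substituting \<open>s = y(t)\<close> in the integral that defines \<open>Bbar\<close> gives
  \<open>Bbar(y(t)) = A(t)\<close>, and letting \<open>t \<rightarrow> T\<close> gives \<open>Bbar(\<infinity>) = A(T)\<close>.
\<close>

section \<open>Integrals with variable upper limit, and limits at infinity\<close>

lemma continuous_on_atLeast_integrable:
  fixes f :: "real \<Rightarrow> real"
  assumes "continuous_on {c..} f" and "c \<le> u"
  shows "f integrable_on {u..v}"
  using assms by (intro integrable_continuous_real) (auto elim: continuous_on_subset)

lemma has_real_derivative_integral_upper:
  fixes f :: "real \<Rightarrow> real"
  assumes "continuous_on {c..} f" and "c < x"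
  shows "((\<lambda>x. integral {c..x} f) has_real_derivative f x) (at x)"
proof -
  have "continuous_on {c..x + 1} f"
    using assms(1) by (rule continuous_on_subset) auto
  then have "((\<lambda>x. integral {c..x} f) has_real_derivative f x) (at x within {c..x + 1})"
    using assms(2) by (intro integral_has_real_derivative) auto
  moreover have "at x within {c..x + 1} = at x"
    using assms(2) by (intro at_within_interior) auto
  ultimately show ?thesis by simp
qed

lemma continuous_on_integral_upper:
  fixes f :: "real \<Rightarrow> real"
  assumes "continuous_on {c..} f"
  shows "continuous_on {c..u} (\<lambda>x. integral {c..x} f)"
  using assms by (intro indefinite_integral_continuous_1 continuous_on_atLeast_integrable) auto

text \<open>For \<open>x < c\<close> the interval \<open>{c..x}\<close> is empty and the integral is
  0, so monotonicity extends to the whole line. This is what allows suprema over all reals in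
  \<open>at_infty_mono_eq_SUP\<close>.\<close>

lemma integral_upper_mono:
  fixes f :: "real \<Rightarrow> real"
  assumes "continuous_on {c..} f" and "\<And>x. c \<le> x \<Longrightarrow> 0 \<le> f x"
  shows "mono (\<lambda>x. integral {c..x} f)"
proof (rule monoI)
  fix x y :: real
  assume "x \<le> y"
  then show "integral {c..x} f \<le> integral {c..y} f"
    using assms by (intro integral_subset_le continuous_on_atLeast_integrable[of c f]) auto
qed

lemma integral_upper_strict_mono_on:
  fixes f :: "real \<Rightarrow> real"
  assumes "continuous_on {c..} f" and "\<And>x. c \<le> x \<Longrightarrow> 0 < f x"
  shows "strict_mono_on {c..} (\<lambda>x. integral {c..x} f)"
proof (rule strict_mono_onI)
  fix x y :: real
  assume "x \<in> {c..}" "y \<in> {c..}" "x < y"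
  moreover have "continuous_on {x..y} (\<lambda>x. integral {c..x} f)"
    using continuous_on_integral_upper[OF assms(1), of y] \<open>x \<in> {c..}\<close>
    by (auto elim: continuous_on_subset)
  moreover have "\<exists>d. ((\<lambda>x. integral {c..x} f) has_real_derivative d) (at z) \<and> 0 < d"
    if "x < z" for z
    using has_real_derivative_integral_upper[OF assms(1), of z] assms(2)[of z] that \<open>x \<in> {c..}\<close>
    by (intro exI[of _ "f z"]) auto
  ultimately show "integral {c..x} f < integral {c..y} f"
    using DERIV_pos_imp_increasing_open[of x y "\<lambda>x. integral {c..x} f"] by blast
qed

lemma at_infty_eq:
  assumes "((\<lambda>x. ereal (f x)) \<longlongrightarrow> l) at_top"
  shows "at_infty f = l"
  unfolding at_infty_def by (rule tendsto_Lim[OF _ assms]) simp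

text \<open>\<open>Lim\<close> carries information only when the limit exists. Monotonicity provides
  it in the extended reals, so the limits of \<open>A_fun\<close> and \<open>B_fun\<close> can be
  compared through bounds on their values.\<close>

lemma at_infty_mono_eq_SUP:
  assumes "mono f"
  shows "at_infty f = (SUP x. ereal (f x))"
proof (rule at_infty_eq, rule order_tendstoI)
  fix l assume "l < (SUP x. ereal (f x))"
  then obtain x where "l < ereal (f x)" by (auto simp: less_SUP_iff)
  then have "l < ereal (f y)" if "x \<le> y" for y
    using monoD[OF assms that] by (meson ereal_less_eq(3) less_le_trans)
  then show "\<forall>\<^sub>F y in at_top. l < ereal (f y)"
    by (auto simp: eventually_at_top_linorder)
next
  fix u assume "(SUP x. ereal (f x)) < u"
  then show "\<forall>\<^sub>F y in at_top. ereal (f y) < u"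
    by (intro always_eventually allI) (meson SUP_upper UNIV_I le_less_trans)
qed

section \<open>Local existence by monotone Picard iteration\<close>

text \<open>The Picard iterates that start at the constant \<open>l\<close> increase, because
  \<open>f\<close> is nonnegative and non-decreasing in \<open>x\<close>, and the condition on
  \<open>K\<close> keeps them below \<open>m\<close>. They converge pointwise, and dominated
  convergence carries the integral equation to the limit. No Lipschitz condition enters, so
  uniqueness is not claimed.\<close>

lemma monotone_ode_local_solution:
  fixes f :: "real \<Rightarrow> real \<Rightarrow> real"
  assumes cont: "continuous_on ({t0..t1} \<times> {l..m}) (\<lambda>(t, x). f t x)"
    and mono: "\<And>t x y. \<lbrakk>t \<in> {t0..t1}; l \<le> x; x \<le> y; y \<le> m\<rbrakk> \<Longrightarrow> f t x \<le> f t y"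
    and bound: "\<And>t x. \<lbrakk>t \<in> {t0..t1}; x \<in> {l..m}\<rbrakk> \<Longrightarrow> 0 \<le> f t x \<and> f t x \<le> K"
    and small: "t0 \<le> t1" "0 \<le> K" "K * (t1 - t0) \<le> m - l"
  obtains z where "continuous_on {t0..t1} z"
    and "\<And>t. t \<in> {t0..t1} \<Longrightarrow> z t \<in> {l..m}"
    and "\<And>t. t \<in> {t0..t1} \<Longrightarrow> z t = l + integral {t0..t} (\<lambda>s. f s (z s))"
proof -
  define \<Phi> where "\<Phi> = (\<lambda>z t. l + integral {t0..t} (\<lambda>s. f s (z s)))"
  define zs where "zs = (\<lambda>n. (\<Phi> ^^ n) (\<lambda>_. l))"
  have zs_0: "zs 0 = (\<lambda>_. l)" and zs_Suc: "zs (Suc n) = \<Phi> (zs n)" for n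
    by (simp_all add: zs_def)
  have "0 \<le> m - l"
    using small by (meson diff_ge_0_iff_ge mult_nonneg_nonneg order_trans)
  \<comment> \<open>The functions on which the Picard operator makes sense: their graphs stay in the
    strip where \<open>f\<close> is controlled. The class is invariant under
    \<open>\<Phi>\<close>.\<close>
  define adm where "adm = (\<lambda>z. continuous_on {t0..t1} z \<and> (\<forall>t\<in>{t0..t1}. z t \<in> {l..m}))"
  have cont_comp: "continuous_on {t0..t1} (\<lambda>s. f s (z s))" if "adm z" for z
  proof -
    have "continuous_on {t0..t1} ((\<lambda>(t, x). f t x) \<circ> (\<lambda>s. (s, z s)))"
      using that by (intro continuous_on_compose continuous_intros continuous_on_subset[OF cont])
        (auto simp: adm_def)
    then show ?thesis by (simp add: o_def)
  qed
  have int_comp: "(\<lambda>s. f s (z s)) integrable_on {t0..t}" if "adm z" "t \<le> t1" for z t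
    using continuous_on_subset[OF cont_comp[OF that(1)]] that(2)
    by (intro integrable_continuous_real) auto
  have adm_\<Phi>: "adm (\<Phi> z)" if "adm z" for z
    unfolding adm_def
  proof (intro conjI ballI)
    show "continuous_on {t0..t1} (\<Phi> z)"
      unfolding \<Phi>_def using int_comp[OF that]
      by (intro continuous_intros indefinite_integral_continuous_1) auto
    fix t assume t: "t \<in> {t0..t1}"
    have "0 \<le> integral {t0..t} (\<lambda>s. f s (z s))"
      using that t bound by (intro integral_nonneg int_comp) (auto simp: adm_def)
    moreover have "integral {t0..t} (\<lambda>s. f s (z s)) \<le> integral {t0..t} (\<lambda>s. K)"
      using that t bound by (intro integral_le int_comp) (auto simp: adm_def)
    moreover have "integral {t0..t} (\<lambda>s. K) \<le> K * (t1 - t0)"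
      using t small(2) by (auto simp: mult.commute intro!: mult_left_mono)
    ultimately show "\<Phi> z t \<in> {l..m}"
      using small(3) by (auto simp: \<Phi>_def)
  qed
  have adm: "adm (zs n)" for n
  proof (induction n)
    case 0
    then show ?case using \<open>0 \<le> m - l\<close> by (simp add: zs_0 adm_def)
  qed (simp add: zs_Suc adm_\<Phi>)
  have range: "zs n t \<in> {l..m}" if "t \<in> {t0..t1}" for n t
    using adm[of n] that by (auto simp: adm_def)
  \<comment> \<open>The base case only says that the first iterate is at least \<open>l\<close>;
    from there the monotonicity of \<open>f\<close> in \<open>x\<close> propagates the
    order.\<close>
  have step: "\<forall>t\<in>{t0..t1}. zs n t \<le> zs (Suc n) t" for n
  proof (induction n)
    case 0
    then show ?case using range[of _ "Suc 0"] by (auto simp: zs_0)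
  next
    case (Suc n)
    have "\<Phi> (zs n) t \<le> \<Phi> (zs (Suc n)) t" if "t \<in> {t0..t1}" for t
    proof -
      have "integral {t0..t} (\<lambda>s. f s (zs n s)) \<le> integral {t0..t} (\<lambda>s. f s (zs (Suc n) s))"
      proof (intro integral_le int_comp adm)
        fix s assume "s \<in> {t0..t}"
        then have s: "s \<in> {t0..t1}" using that by auto
        then show "f s (zs n s) \<le> f s (zs (Suc n) s)"
          using Suc range[OF s, of n] range[OF s, of "Suc n"] by (intro mono) auto
      qed (use that in auto)
      then show ?thesis by (simp add: \<Phi>_def)
    qed
    then show ?case by (simp add: zs_Suc)
  qed
  have "\<exists>y. (\<lambda>n. zs n t) \<longlonglongrightarrow> y" if "t \<in> {t0..t1}" for t
  proof -
    have "incseq (\<lambda>n. zs n t)" using step that by (intro incseq_SucI) auto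
    moreover have "\<forall>n. zs n t \<le> m" using range[OF that] by auto
    ultimately show ?thesis by (metis incseq_convergent)
  qed
  then obtain z where z: "\<And>t. t \<in> {t0..t1} \<Longrightarrow> (\<lambda>n. zs n t) \<longlonglongrightarrow> z t"
    by metis
  have z_range: "z t \<in> {l..m}" if "t \<in> {t0..t1}" for t
    using closed_sequentially[OF closed_atLeastAtMost _ z[OF that]] range[OF that] by blast
  have conv: "(\<lambda>n. f t (zs n t)) \<longlonglongrightarrow> f t (z t)" if "t \<in> {t0..t1}" for t
  proof -
    have "continuous_on {l..m} ((\<lambda>(t, x). f t x) \<circ> (\<lambda>x. (t, x)))"
      using that by (intro continuous_on_compose continuous_intros continuous_on_subset[OF cont]) auto
    then have "continuous_on {l..m} (f t)" by (simp add: o_def)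
    then show ?thesis
      by (rule continuous_on_tendsto_compose[OF _ z[OF that] z_range[OF that]])
        (use range[OF that] in auto)
  qed
  \<comment> \<open>The convergence is only pointwise and \<open>z\<close> is not yet known to be
    continuous, so integrability of the limit integrand also comes from domination by the constant
    \<open>K\<close>.\<close>
  have dom: "(\<lambda>s. f s (z s)) integrable_on {t0..t}"
    "(\<lambda>n. integral {t0..t} (\<lambda>s. f s (zs n s))) \<longlonglongrightarrow> integral {t0..t} (\<lambda>s. f s (z s))"
    if "t \<in> {t0..t1}" for t
  proof -
    have bd: "norm (f s (zs n s)) \<le> K" if "s \<in> {t0..t}" for n s
      using bound[OF _ range, of s s n] that \<open>t \<in> {t0..t1}\<close> by auto
    note dc = dominated_convergence[where f = "\<lambda>n s. f s (zs n s)" and g = "\<lambda>s. f s (z s)"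
        and h = "\<lambda>_. K" and S = "{t0..t}"]
    show "(\<lambda>s. f s (z s)) integrable_on {t0..t}"
      by (rule dc(1)) (use that bd conv int_comp adm in auto)
    show "(\<lambda>n. integral {t0..t} (\<lambda>s. f s (zs n s))) \<longlonglongrightarrow> integral {t0..t} (\<lambda>s. f s (z s))"
      by (rule dc(2)) (use that bd conv int_comp adm in auto)
  qed
  have eq: "z t = l + integral {t0..t} (\<lambda>s. f s (z s))" if "t \<in> {t0..t1}" for t
  proof (rule LIMSEQ_unique)
    show "(\<lambda>n. zs (Suc n) t) \<longlonglongrightarrow> z t"
      using z[OF that] by (rule LIMSEQ_Suc)
    show "(\<lambda>n. zs (Suc n) t) \<longlonglongrightarrow> l + integral {t0..t} (\<lambda>s. f s (z s))"
      unfolding zs_Suc \<Phi>_def by (intro tendsto_intros dom that)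
  qed
  \<comment> \<open>Continuity of \<open>z\<close> is recovered afterwards, from the integral
    equation that it satisfies.\<close>
  have "continuous_on {t0..t1} (\<lambda>t. l + integral {t0..t} (\<lambda>s. f s (z s)))"
    using dom(1)[of t1] small(1) by (intro continuous_intros indefinite_integral_continuous_1) auto
  then have "continuous_on {t0..t1} z"
    by (rule continuous_on_eq) (simp add: eq[symmetric])
  then show thesis
    using z_range eq by (rule that)
qed

section \<open>Standing hypotheses, and basic properties of A and B\<close>

locale explosive_ode =
  fixes a b g :: "real \<Rightarrow> real" and x0 :: real
  assumes a_cont: "continuous_on {0..} a" and a_pos: "\<And>t. 0 \<le> t \<Longrightarrow> 0 < a t"
    and b_cont: "continuous_on {0..} b" and b_pos: "\<And>x. 0 \<le> x \<Longrightarrow> 0 < b x"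
    and g_cont: "continuous_on {0..} g" and g_nonneg: "\<And>t. 0 \<le> t \<Longrightarrow> 0 \<le> g t"
    and x0_pos: "0 < x0"
    and b_mono: "mono_on {0..} b"
begin

text \<open>Separate inner functions \<open>u\<close> and \<open>v\<close> cover two uses: the
  right-hand side as a function of the pair of time and state, and its values along a curve. The
  range conditions are there because \<open>a\<close>, \<open>b\<close> and \<open>g\<close> are
  continuous only on \<open>{0..}\<close>.\<close>

lemma rhs_continuous:
  assumes "continuous_on S u" "continuous_on S v" "u ` S \<subseteq> {0..}" "v ` S \<subseteq> {0..}"
  shows "continuous_on S (\<lambda>s. a (u s) * b (v s + g (u s)))"
proof -
  have "continuous_on S (\<lambda>s. a (u s))" "continuous_on S (\<lambda>s. g (u s))"
    using a_cont g_cont assms by (auto intro: continuous_on_compose2)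
  moreover from this(2) have "continuous_on S (\<lambda>s. b (v s + g (u s)))"
    using assms g_nonneg
    by (intro continuous_on_compose2[OF b_cont] continuous_intros)
      (auto intro!: add_nonneg_nonneg simp: image_subset_iff)
  ultimately show ?thesis by (intro continuous_intros)
qed

lemma B_integrand: "continuous_on {x0..} (\<lambda>s. 1 / b s)" "\<And>s. x0 \<le> s \<Longrightarrow> 0 \<le> 1 / b s"
proof -
  have "continuous_on {x0..} b"
    using b_cont by (rule continuous_on_subset) (use x0_pos in auto)
  then show "continuous_on {x0..} (\<lambda>s. 1 / b s)"
    using b_pos x0_pos by (intro continuous_intros) (auto, metis less_irrefl less_le order_trans)
  show "\<And>s. x0 \<le> s \<Longrightarrow> 0 \<le> 1 / b s"
    using b_pos x0_pos by (simp add: less_imp_le)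
qed

lemma A_mono: "mono (A_fun a)"
  unfolding A_fun_def using integral_upper_mono[OF a_cont] a_pos by (simp add: less_imp_le)

lemma A_strict_mono_on: "strict_mono_on {0..} (A_fun a)"
  unfolding A_fun_def using integral_upper_strict_mono_on[OF a_cont] a_pos by simp

lemma A_continuous_on: "continuous_on {0..u} (A_fun a)"
  unfolding A_fun_def by (rule continuous_on_integral_upper[OF a_cont])

lemma A_deriv: "0 < t \<Longrightarrow> (A_fun a has_real_derivative a t) (at t)"
  unfolding A_fun_def by (rule has_real_derivative_integral_upper[OF a_cont])

lemma B_mono: "mono (B_fun b x0)"
  unfolding B_fun_def by (rule integral_upper_mono[OF B_integrand])

section \<open>Growth and lifetime of a single solution\<close>

context
  fixes T :: ereal and y :: "real \<Rightarrow> real"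
  assumes sol: "solves a b g x0 T y"
begin

lemma y_0: "y 0 = x0" and T_pos: "0 < T"
  using sol by (auto simp: solves_def)

lemma y_deriv: "0 < t \<Longrightarrow> ereal t < T \<Longrightarrow> (y has_real_derivative a t * b (y t + g t)) (at t)"
  using sol by (auto simp: solves_def)

lemma y_continuous_on: "S \<subseteq> {t. 0 \<le> t \<and> ereal t < T} \<Longrightarrow> continuous_on S y"
  using sol by (auto simp: solves_def elim: continuous_on_subset)

lemma atLeastAtMost_subset_dom: "ereal t < T \<Longrightarrow> 0 \<le> s \<Longrightarrow> {s..t} \<subseteq> {t. 0 \<le> t \<and> ereal t < T}"
  by (auto intro: le_less_trans[of _ "ereal t"])

lemma y_less: "y s < y t" if "0 \<le> s" "s < t" "ereal t < T"
proof (rule DERIV_pos_imp_increasing_open[OF that(2)])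
  show "continuous_on {s..t} y"
    using that by (intro y_continuous_on atLeastAtMost_subset_dom)
  fix r assume r: "s < r" "r < t"
  then have "ereal r < T" using that by (auto intro: less_trans[of _ "ereal t"])
  moreover from this have "0 < a r * b (y r + g r)"
    using sol r that by (intro mult_pos_pos a_pos b_pos) (auto simp: solves_def)
  ultimately show "\<exists>d. (y has_real_derivative d) (at r) \<and> 0 < d"
    using y_deriv[of r] r that by auto
qed

lemma y_ge_x0: "0 \<le> t \<Longrightarrow> ereal t < T \<Longrightarrow> x0 \<le> y t"
  using y_less[of 0 t] y_0 by (cases "t = 0") auto

lemma y_gt_x0: "0 < t \<Longrightarrow> ereal t < T \<Longrightarrow> x0 < y t"
  using y_less[of 0 t] y_0 by auto

text \<open>For \<open>h = 1 / b\<close> this compares \<open>B(y(t))\<close> with \<open>A(t)\<close>; for the integrand of \<open>Bbar\<close> it is the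
  substitution \<open>s = y(u)\<close>.\<close>

lemma integral_along_solution:
  fixes h :: "real \<Rightarrow> real"
  assumes "continuous_on {x0..} h" "0 \<le> t" "ereal t < T"
  defines "D \<equiv> \<lambda>s. integral {x0..y s} h - A_fun a s"
  shows "continuous_on {0..t} D" "D 0 = 0"
    and "\<And>s. 0 < s \<Longrightarrow> s \<le> t \<Longrightarrow>
      (D has_real_derivative h (y s) * (a s * b (y s + g s)) - a s) (at s)"
proof -
  have lt: "ereal s < T" if "s \<le> t" for s
    using that assms(3) by (auto intro: le_less_trans[of _ "ereal t"])
  have "y ` {0..t} \<subseteq> {x0..y t}"
    using y_ge_x0 lt y_less[OF _ _ assms(3)] by (force simp: le_less)
  then show "continuous_on {0..t} D"
    unfolding D_def
    by (intro continuous_on_diff A_continuous_on y_continuous_on atLeastAtMost_subset_dom assms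
        continuous_on_compose2[OF continuous_on_integral_upper[OF assms(1)]]) auto
  show "D 0 = 0" by (simp add: D_def y_0 A_fun_def)
  fix s assume s: "0 < s" "s \<le> t"
  have "((\<lambda>s. integral {x0..y s} h) has_real_derivative h (y s) * (a s * b (y s + g s))) (at s)"
    using s lt by (intro DERIV_chain2[OF has_real_derivative_integral_upper] assms y_gt_x0 y_deriv)
  then show "(D has_real_derivative h (y s) * (a s * b (y s + g s)) - a s) (at s)"
    unfolding D_def using s by (intro DERIV_diff A_deriv)
qed

lemma A_le_B:
  assumes t: "0 \<le> t" "ereal t < T"
  shows "A_fun a t \<le> B_fun b x0 (y t)"
proof -
  define D where "D = (\<lambda>s. integral {x0..y s} (\<lambda>s. 1 / b s) - A_fun a s)"
  note D = integral_along_solution[OF B_integrand(1) t, folded D_def]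
  have "D 0 \<le> D t"
  proof (rule DERIV_nonneg_imp_increasing_open[OF t(1)])
    fix s assume s: "0 < s" "s < t"
    then have "ereal s < T" using t by (auto intro: less_trans[of _ "ereal t"])
    then have "0 \<le> y s" using y_ge_x0[of s] s x0_pos by auto
    \<comment> \<open>Here the monotonicity of \<open>b\<close> and the sign of \<open>g\<close>
      enter: the derivative of B along the solution is \<open>a s\<close> times a ratio that is at
      least 1.\<close>
    then have "0 < b (y s)" "b (y s) \<le> b (y s + g s)"
      using b_pos g_nonneg[of s] s by (auto intro!: mono_onD[OF b_mono])
    then have "a s \<le> 1 / b (y s) * (a s * b (y s + g s))"
      using a_pos[of s] s by (simp add: field_simps)
    then show "\<exists>d. (D has_real_derivative d) (at s) \<and> 0 \<le> d"
      using D(3)[of s] s by (intro exI[of _ "1 / b (y s) * (a s * b (y s + g s)) - a s"]) auto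
  qed (rule D(1))
  then show ?thesis using D(2) by (simp add: D_def B_fun_def)
qed

lemma lifetime_finite:
  assumes "at_infty (B_fun b x0) < at_infty (A_fun a)"
  obtains T' where "T = ereal T'" "0 < T'"
proof (cases T)
  case PInf
  have "ereal (A_fun a t) \<le> (SUP x. ereal (B_fun b x0 x))" for t
  proof -
    \<comment> \<open>The supremum runs over all real \<open>t\<close>, while \<open>A_le_B\<close>
      needs a nonnegative time; hence \<open>max t 0\<close>.\<close>
    have "A_fun a t \<le> A_fun a (max t 0)" by (rule monoD[OF A_mono]) simp
    also have "\<dots> \<le> B_fun b x0 (y (max t 0))" using PInf by (intro A_le_B) (auto simp: max_def)
    finally show ?thesis by (auto intro: SUP_upper2)
  qed
  then have "at_infty (A_fun a) \<le> at_infty (B_fun b x0)"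
    by (simp add: at_infty_mono_eq_SUP[OF A_mono] at_infty_mono_eq_SUP[OF B_mono] SUP_least)
  then show ?thesis using assms by simp
qed (use T_pos that in auto)

end

section \<open>Continuation of bounded solutions\<close>

text \<open>A bounded increasing function has a left limit at \<open>T\<close>, and adding this
  value makes it continuous on the closed interval. The equation is put in integrated form because
  this form remains valid at the endpoint, where no derivative is available; the fundamental theorem
  needs derivatives only in the interior.\<close>

lemma bounded_solution_closure:
  assumes sol: "solves a b g x0 (ereal T) y"
    and bdd: "\<And>t. 0 \<le> t \<Longrightarrow> t < T \<Longrightarrow> y t \<le> M"
  obtains w where "continuous_on {0..T} w" "\<And>t. 0 \<le> t \<Longrightarrow> t < T \<Longrightarrow> w t = y t"
    "\<And>t. t \<in> {0..T} \<Longrightarrow> x0 \<le> w t"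
    "\<And>t. t \<in> {0..T} \<Longrightarrow> ((\<lambda>s. a s * b (w s + g s)) has_integral w t - x0) {0..t}"
proof -
  have T: "0 < T" using T_pos[OF sol] by simp
  define l where "l = (SUP t\<in>{0..<T}. y t)"
  have bdd': "bdd_above (y ` {0..<T})"
    using bdd by (auto intro!: bdd_aboveI[of _ M])
  have y_le_l: "y t \<le> l" if "0 \<le> t" "t < T" for t
    unfolding l_def using that by (intro cSUP_upper bdd') auto
  have lim: "(y \<longlongrightarrow> l) (at_left T)"
  proof (rule order_tendstoI)
    fix c assume "c < l"
    then obtain s where s: "0 \<le> s" "s < T" "c < y s"
      unfolding l_def using T by (subst (asm) less_cSUP_iff[OF _ bdd']) auto
    have "c < y t" if "s < t" "t < T" for t
      using y_less[OF sol, of s t] s that by auto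
    then show "\<forall>\<^sub>F t in at_left T. c < y t"
      using s(2) by (auto simp: eventually_at_left_field)
  next
    fix c assume "l < c"
    then show "\<forall>\<^sub>F t in at_left T. y t < c"
      using T y_le_l \<open>l < c\<close> unfolding eventually_at_left_field
      by (intro exI[of _ 0]) (auto intro!: le_less_trans[of _ l])
  qed
  define w where "w = (\<lambda>t. if t < T then y t else l)"
  have w_eq: "w t = y t" if "t < T" for t
    using that by (simp add: w_def)
  have "continuous (at t within {0..T}) w" if t: "t \<in> {0..T}" for t
  proof (cases "t = T")
    case True
    have "(w \<longlongrightarrow> l) (at_left T)"
      by (rule Lim_transform_eventually[OF lim])
        (auto simp: w_def eventually_at_left_field intro!: exI[of _ 0] T)
    moreover have "at T within {0..T} = at_left T"
      using T by (rule at_within_Icc_at_left)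
    ultimately show ?thesis using True by (simp add: continuous_within w_def)
  next
    case False
    have "continuous_on {0..<T} w"
      by (rule continuous_on_eq[OF y_continuous_on[OF sol]]) (auto simp: w_def)
    then have "continuous (at t within {0..<T}) w"
      using t False by (auto simp: continuous_on_eq_continuous_within)
    moreover have "at t within {0..T} = at t within {0..<T}"
      using t False by (intro at_within_nhd[of t "{..<T}"]) auto
    ultimately show ?thesis by (simp add: continuous_within)
  qed
  then have w_cont: "continuous_on {0..T} w"
    by (auto simp: continuous_on_eq_continuous_within)
  have w_ge: "x0 \<le> w t" if "t \<in> {0..T}" for t
    using y_ge_x0[OF sol, of t] y_le_l[of 0] y_0[OF sol] T that by (auto simp: w_def)
  have w_int: "((\<lambda>s. a s * b (w s + g s)) has_integral w t - x0) {0..t}" if "t \<in> {0..T}" for t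
  proof -
    have "((\<lambda>s. a s * b (w s + g s)) has_integral w t - w 0) {0..t}"
    proof (rule fundamental_theorem_of_calculus_interior)
      show "continuous_on {0..t} w"
        using w_cont by (rule continuous_on_subset) (use that in auto)
      fix s assume s: "s \<in> {0<..<t}"
      have "(y has_real_derivative a s * b (w s + g s)) (at s)"
        using y_deriv[OF sol, of s] s that by (auto simp: w_def)
      then have "(w has_real_derivative a s * b (w s + g s)) (at s)"
        by (rule has_field_derivative_transform_within_open[of _ _ _ "{..<T}"])
          (use s that in \<open>auto simp: w_def\<close>)
      then show "(w has_vector_derivative a s * b (w s + g s)) (at s)"
        by (simp add: has_real_derivative_iff_has_vector_derivative)
    qed (use that in auto)
    then show ?thesis using T y_0[OF sol] by (simp add: w_def)
  qed
  show thesis by (rule that[OF w_cont w_eq w_ge w_int])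
qed

lemma local_continuation:
  assumes "0 \<le> T" "0 \<le> l"
  obtains T' v where "T < T'" "continuous_on {T..T'} v" "\<And>t. t \<in> {T..T'} \<Longrightarrow> l \<le> v t"
    "\<And>t. t \<in> {T..T'} \<Longrightarrow> v t = l + integral {T..t} (\<lambda>s. a s * b (v s + g s))"
proof -
  define F where "F = (\<lambda>t x. a t * b (x + g t))"
  have F_cont: "continuous_on ({T..T + 1} \<times> {l..l + 1}) (\<lambda>(t, x). F t x)"
    unfolding F_def case_prod_beta
    using assms by (intro rhs_continuous continuous_intros) auto
  have "bounded ((\<lambda>(t, x). F t x) ` ({T..T + 1} \<times> {l..l + 1}))"
    by (intro compact_imp_bounded compact_continuous_image F_cont compact_Times) auto
  then obtain K where K: "0 < K" "\<And>p. p \<in> {T..T + 1} \<times> {l..l + 1} \<Longrightarrow> norm (case p of (t, x) \<Rightarrow> F t x) \<le> K"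
    unfolding bounded_pos by blast
  \<comment> \<open>The bound \<open>1 / K\<close> keeps the rise of the solution at most 1, the
    height of the box; the bound 1 keeps the time inside the box on which \<open>K\<close> was
    obtained.\<close>
  define \<epsilon> where "\<epsilon> = min 1 (1 / K)"
  have \<epsilon>: "0 < \<epsilon>" "\<epsilon> \<le> 1" "K * \<epsilon> \<le> 1"
    using K(1) by (auto simp: \<epsilon>_def min_def field_simps)
  have F_nonneg: "0 \<le> F t x" if "T \<le> t" "l \<le> x" for t x
    unfolding F_def using that assms
    by (intro mult_nonneg_nonneg less_imp_le[OF a_pos] less_imp_le[OF b_pos] add_nonneg_nonneg g_nonneg) auto
  obtain v where v: "continuous_on {T..T + \<epsilon>} v" "\<And>t. t \<in> {T..T + \<epsilon>} \<Longrightarrow> v t \<in> {l..l + 1}"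
    "\<And>t. t \<in> {T..T + \<epsilon>} \<Longrightarrow> v t = l + integral {T..t} (\<lambda>s. F s (v s))"
  proof (rule monotone_ode_local_solution[of T "T + \<epsilon>" l "l + 1" F K])
    show "continuous_on ({T..T + \<epsilon>} \<times> {l..l + 1}) (\<lambda>(t, x). F t x)"
      using F_cont by (rule continuous_on_subset) (use \<epsilon> in auto)
    show "F t x \<le> F t y" if "t \<in> {T..T + \<epsilon>}" "l \<le> x" "x \<le> y" "y \<le> l + 1" for t x y
      unfolding F_def using that assms g_nonneg[of t]
      by (intro mult_left_mono mono_onD[OF b_mono] less_imp_le[OF a_pos]) auto
    show "0 \<le> F t x \<and> F t x \<le> K" if "t \<in> {T..T + \<epsilon>}" "x \<in> {l..l + 1}" for t x
      using K(2)[of "(t, x)"] F_nonneg[of t x] that \<epsilon> by auto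
  qed (use \<epsilon> K(1) in auto)
  show thesis
    by (rule that[of "T + \<epsilon>" v]) (use \<epsilon> v in \<open>auto simp: F_def\<close>)
qed

text \<open>The closed-up solution and a local solution started at its end value are glued at
  \<open>T\<close>. Their integral equations add up to a single one on \<open>{0..T'}\<close> with
  continuous integrand; differentiating it yields the equation at every interior time, including
  \<open>T\<close>, with no matching of one-sided derivatives.\<close>

lemma bounded_solution_extends:
  assumes sol: "solves a b g x0 (ereal T) y"
    and bdd: "\<And>t. 0 \<le> t \<Longrightarrow> t < T \<Longrightarrow> y t \<le> M"
  obtains T' z where "T < T'" "solves a b g x0 (ereal T') z"
    "\<And>t. 0 \<le> t \<Longrightarrow> t < T \<Longrightarrow> z t = y t"
proof -
  have T: "0 < T" using T_pos[OF sol] by simp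
  obtain w where w: "continuous_on {0..T} w" "\<And>t. 0 \<le> t \<Longrightarrow> t < T \<Longrightarrow> w t = y t"
    "\<And>t. t \<in> {0..T} \<Longrightarrow> x0 \<le> w t"
    "\<And>t. t \<in> {0..T} \<Longrightarrow> ((\<lambda>s. a s * b (w s + g s)) has_integral w t - x0) {0..t}"
    using bounded_solution_closure[OF sol bdd] by metis
  have "0 \<le> w T" using w(3)[of T] T x0_pos by auto
  then obtain T' v where T': "T < T'" and v: "continuous_on {T..T'} v"
    "\<And>t. t \<in> {T..T'} \<Longrightarrow> w T \<le> v t"
    "\<And>t. t \<in> {T..T'} \<Longrightarrow> v t = w T + integral {T..t} (\<lambda>s. a s * b (v s + g s))"
    using local_continuation[of T "w T"] T by (metis less_imp_le)
  define z where "z = (\<lambda>t. if t \<le> T then w t else v t)"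
  define F where "F = (\<lambda>s. a s * b (z s + g s))"
  have vT: "v T = w T" using v(3)[of T] T' by simp
  have z_v: "z t = v t" if "T \<le> t" for t
    using that vT by (auto simp: z_def)
  have z_cont: "continuous_on {0..T'} z"
  proof -
    have "continuous_on ({0..T} \<union> {T..T'}) z"
      unfolding z_def using w(1) v(1) vT by (intro continuous_on_If) auto
    then show ?thesis using T T' by (simp add: ivl_disj_un_two_touch)
  qed
  have z_ge: "x0 \<le> z t" if "t \<in> {0..T'}" for t
    using w(3)[of t] w(3)[of T] v(2)[of t] that T by (auto simp: z_def)
  have F_cont: "continuous_on {0..T'} F"
    unfolding F_def using z_ge x0_pos by (intro rhs_continuous z_cont continuous_intros) force+
  have z_int: "z t = x0 + integral {0..t} F" if t: "t \<in> {0..T'}" for t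
  proof -
    have head: "(F has_integral w s - x0) {0..s}" if "s \<in> {0..T}" for s
      using w(4)[OF that] by (rule has_integral_eq[rotated]) (use that in \<open>auto simp: F_def z_def\<close>)
    show ?thesis
    proof (cases "t \<le> T")
      case True
      then show ?thesis using head[of t] t by (auto simp: z_def dest: integral_unique)
    next
      case False
      have "integral {0..t} F = integral {0..T} F + integral {T..t} F"
        using T False t continuous_on_subset[OF F_cont]
        by (intro Henstock_Kurzweil_Integration.integral_combine[symmetric] integrable_continuous_real) auto
      moreover have "integral {0..T} F = w T - x0"
        using head[of T] T by (auto dest: integral_unique)
      moreover have "integral {T..t} F = integral {T..t} (\<lambda>s. a s * b (v s + g s))"
        by (rule integral_cong) (auto simp: F_def z_v)
      ultimately show ?thesis using v(3)[of t] z_v[of t] False t by auto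
    qed
  qed
  have "solves a b g x0 (ereal T') z"
    unfolding solves_def
  proof (intro conjI allI impI)
    show "0 < ereal T'" using T T' by simp
    show "z 0 = x0" using z_int[of 0] T T' by simp
    show "continuous_on {t. 0 \<le> t \<and> ereal t < ereal T'} z"
      using z_cont by (rule continuous_on_subset) auto
    show "0 \<le> z t + g t" if "0 \<le> t \<and> ereal t < ereal T'" for t
      using z_ge[of t] g_nonneg[of t] x0_pos that by auto
    show "(z has_real_derivative a t * b (z t + g t)) (at t)" if "0 < t \<and> ereal t < ereal T'" for t
    proof -
      have t: "t \<in> {0<..<T'}" using that by auto
      have "((\<lambda>t. integral {0..t} F) has_real_derivative F t) (at t within {0..T'})"
        using F_cont by (rule integral_has_real_derivative) (use t in auto)
      moreover have "at t within {0..T'} = at t"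
        using t by (intro at_within_interior) auto
      ultimately have "((\<lambda>t. x0 + integral {0..t} F) has_real_derivative F t) (at t)"
        by (auto intro!: derivative_eq_intros)
      then have "(z has_real_derivative F t) (at t)"
        by (rule has_field_derivative_transform_within_open[of _ _ _ "{0<..<T'}"])
          (use t z_int in auto)
      then show ?thesis by (simp add: F_def)
    qed
  qed
  then show thesis
    by (rule that[OF T']) (use w(2) in \<open>auto simp: z_def\<close>)
qed

lemma maximal_solution_unbounded:
  assumes sol: "solves a b g x0 (ereal T) y"
    and max: "\<not> (\<exists>T' z. ereal T < T' \<and> solves a b g x0 T' z \<and>
      (\<forall>t. 0 \<le> t \<and> ereal t < ereal T \<longrightarrow> z t = y t))"
  obtains t where "0 \<le> t" "t < T" "c < y t"
proof (rule ccontr)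
  assume "\<not> thesis"
  then have "y t \<le> c" if "0 \<le> t" "t < T" for t
    using that \<open>\<And>t. \<lbrakk>0 \<le> t; t < T; c < y t\<rbrakk> \<Longrightarrow> thesis\<close> by (meson not_le)
  then obtain T' z where "T < T'" "solves a b g x0 (ereal T') z"
    "\<And>t. 0 \<le> t \<Longrightarrow> t < T \<Longrightarrow> z t = y t"
    using bounded_solution_extends[OF sol] by metis
  then show False using max by (metis ereal_less(2) less_ereal.simps(1))
qed

section \<open>The inverse of an exploding solution, and Bbar\<close>

text \<open>Unboundedness gives surjectivity: each \<open>s\<close> at or above \<open>x0\<close>
  lies between \<open>y 0\<close> and some larger value of \<open>y\<close>, so the intermediate
  value theorem applies.\<close>

lemma exploding_solution_bij:
  assumes sol: "solves a b g x0 (ereal T) y"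
    and unbdd: "\<And>c. \<exists>t. 0 \<le> t \<and> t < T \<and> c < y t"
  shows "bij_betw y {0..<T} {x0..}"
  unfolding bij_betw_def
proof
  show "inj_on y {0..<T}"
    using y_less[OF sol] by (intro linorder_inj_onI') force
  show "y ` {0..<T} = {x0..}"
  proof
    show "y ` {0..<T} \<subseteq> {x0..}" using y_ge_x0[OF sol] by auto
    show "{x0..} \<subseteq> y ` {0..<T}"
    proof
      fix s assume s: "s \<in> {x0..}"
      obtain t where t: "0 \<le> t" "t < T" "s < y t" using unbdd by blast
      have "\<exists>r\<ge>0. r \<le> t \<and> y r = s"
        using t s y_0[OF sol] by (intro IVT' y_continuous_on[OF sol] atLeastAtMost_subset_dom[OF sol]) auto
      then show "s \<in> y ` {0..<T}" using t by force
    qed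
  qed
qed

text \<open>A continuous injection on a compact interval \<open>{0..t}\<close> has a continuous
  inverse. Continuity is a local matter, and for \<open>s < y t\<close> the interval
  \<open>{x0..y t}\<close> is a neighbourhood of \<open>s\<close> relative to
  \<open>{x0..}\<close>.\<close>

lemma exploding_solution_inverse_continuous:
  assumes sol: "solves a b g x0 (ereal T) y"
    and unbdd: "\<And>c. \<exists>t. 0 \<le> t \<and> t < T \<and> c < y t"
  shows "continuous_on {x0..} (the_inv_into {0..<T} y)" (is "continuous_on _ ?\<tau>")
proof -
  have bij: "bij_betw y {0..<T} {x0..}" by (rule exploding_solution_bij[OF assms])
  have "continuous (at s within {x0..}) ?\<tau>" if s: "s \<in> {x0..}" for s
  proof -
    obtain t where t: "0 \<le> t" "t < T" "s < y t" using unbdd by blast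
    have "continuous_on (y ` {0..t}) ?\<tau>"
      using t bij
      by (intro continuous_on_inv y_continuous_on[OF sol] atLeastAtMost_subset_dom[OF sol])
        (auto simp: bij_betw_def intro!: the_inv_into_f_f)
    moreover have "{x0..y t} \<subseteq> y ` {0..t}"
    proof
      fix r assume "r \<in> {x0..y t}"
      then have "\<exists>q\<ge>0. q \<le> t \<and> y q = r"
        using t y_0[OF sol] by (intro IVT' y_continuous_on[OF sol] atLeastAtMost_subset_dom[OF sol]) auto
      then show "r \<in> y ` {0..t}" by force
    qed
    ultimately have "continuous_on {x0..y t} ?\<tau>" by (rule continuous_on_subset)
    then have "continuous (at s within {x0..y t}) ?\<tau>"
      using s t by (auto simp: continuous_on_eq_continuous_within)
    moreover have "at s within {x0..} = at s within {x0..y t}"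
      using s t by (intro at_within_nhd[of s "{..<y t}"]) auto
    ultimately show ?thesis by (simp add: continuous_within)
  qed
  then show ?thesis by (auto simp: continuous_on_eq_continuous_within)
qed

text \<open>Since \<open>\<tau>\<close> inverts \<open>y\<close>, the integrand of Bbar at
  \<open>y s\<close> is exactly \<open>1 / b (y s + g s)\<close>. The inequality of
  \<open>A_le_B\<close> thus becomes an equality: the difference \<open>D\<close> has zero
  derivative and starts at 0.\<close>

lemma Bbar_along_solution:
  assumes sol: "solves a b g x0 (ereal T) y"
    and unbdd: "\<And>c. \<exists>t. 0 \<le> t \<and> t < T \<and> c < y t"
    and t: "0 \<le> t" "t < T"
  shows "integral {x0..y t} (\<lambda>s. 1 / b (s + g (the_inv_into {0..<T} y s))) = A_fun a t"
proof -
  define \<tau> where "\<tau> = the_inv_into {0..<T} y"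
  define h where "h = (\<lambda>s. 1 / b (s + g (\<tau> s)))"
  have bij: "bij_betw y {0..<T} {x0..}" by (rule exploding_solution_bij[OF assms(1,2)])
  have \<tau>_y: "\<tau> (y s) = s" if "0 \<le> s" "s < T" for s
    unfolding \<tau>_def using bij that by (auto simp: bij_betw_def intro: the_inv_into_f_f)
  have \<tau>_mem: "\<tau> s \<in> {0..<T}" if "x0 \<le> s" for s
    unfolding \<tau>_def using bij that by (intro the_inv_into_into[OF _ _ order_refl]) (auto simp: bij_betw_def)
  have arg: "0 \<le> s + g (\<tau> s)" if "x0 \<le> s" for s
    using g_nonneg[of "\<tau> s"] \<tau>_mem[OF that] that x0_pos by auto
  have "continuous_on {x0..} (\<lambda>s. b (s + g (\<tau> s)))"
    using exploding_solution_inverse_continuous[OF assms(1,2), folded \<tau>_def] arg \<tau>_mem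
    by (intro continuous_on_compose2[OF b_cont] continuous_on_compose2[OF g_cont] continuous_intros) auto
  then have h_cont: "continuous_on {x0..} h"
    unfolding h_def using b_pos[OF arg]
    by (intro continuous_intros) (auto, metis less_irrefl)
  define D where "D = (\<lambda>s. integral {x0..y s} h - A_fun a s)"
  have t': "ereal t < ereal T" using t by simp
  note D = integral_along_solution[OF sol h_cont t(1) t', folded D_def]
  have "D t = D 0"
  proof (cases "t = 0")
    case False
    show ?thesis
    proof (rule DERIV_isconst2[OF _ D(1)])
      fix s assume s: "0 < s" "s < t"
      then have "0 < b (y s + g s)"
        using y_ge_x0[OF sol, of s] g_nonneg[of s] x0_pos t by (intro b_pos) auto
      then show "(D has_real_derivative 0) (at s)"
        using D(3)[of s] s t by (simp add: h_def \<tau>_y)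
    qed (use t False in auto)
  qed simp
  then show ?thesis using D(2) by (simp add: D_def h_def \<tau>_def)
qed

end

section \<open>The time of explosion\<close>

theorem theorem5:
  fixes a b g :: "real \<Rightarrow> real" and x0 :: real and Y :: "real \<Rightarrow> ereal"
  assumes "continuous_on {0..} a" and "\<forall>t\<ge>0. a t > 0"
    and "continuous_on {0..} b" and "\<forall>x\<ge>0. b x > 0"
    and "continuous_on {0..} g" and "\<forall>t\<ge>0. g t \<ge> 0"
    and "x0 > 0"
    and "mono_on {0..} b"
    and "at_infty (B_fun b x0) < at_infty (A_fun a)"
    and "maximal_solution a b g x0 Y"
  shows "explodes_in_finite_time Y \<and>
    at_infty (Bbar_fun b g x0 Y) \<in> (\<lambda>t. ereal (A_fun a t)) ` {0..} \<and>
    explosion_time Y = ereal (A_inv a (at_infty (Bbar_fun b g x0 Y)))"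
proof -
  interpret explosive_ode a b g x0
    using assms by unfold_locales auto
  obtain T\<^sub>e y where sol\<^sub>e: "solves a b g x0 T\<^sub>e y"
    and max\<^sub>e: "\<not> (\<exists>T' z. T\<^sub>e < T' \<and> solves a b g x0 T' z \<and> (\<forall>t. 0 \<le> t \<and> ereal t < T\<^sub>e \<longrightarrow> z t = y t))"
    and Y\<^sub>e: "\<And>t. 0 \<le> t \<Longrightarrow> Y t = (if ereal t < T\<^sub>e then ereal (y t) else \<infinity>)"
    using assms(10) unfolding maximal_solution_def by blast
  obtain T where T: "T\<^sub>e = ereal T" "0 < T"
    using lifetime_finite[OF sol\<^sub>e assms(9)] by blast
  note sol = sol\<^sub>e[unfolded T(1)]
  have Y: "Y t = (if t < T then ereal (y t) else \<infinity>)" if "0 \<le> t" for t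
    using Y\<^sub>e[OF that] by (simp add: T(1))
  have unbdd: "\<exists>t. 0 \<le> t \<and> t < T \<and> c < y t" for c
    using maximal_solution_unbounded[OF sol max\<^sub>e[unfolded T(1)]] by metis
  define \<tau> where "\<tau> = the_inv_into {0..<T} y"
  have bij: "bij_betw y {0..<T} {x0..}" by (rule exploding_solution_bij[OF sol unbdd])
  have dom: "{t. 0 \<le> t \<and> Y t < \<infinity>} = {0..<T}"
    using Y by (auto split: if_splits)
  \<comment> \<open>Both inverses are definite descriptions over the same set, and their predicates
    agree because \<open>ereal\<close> is injective. The equality therefore holds for every
    \<open>s\<close>, even outside the range of \<open>y\<close>.\<close>
  have "Y_inv Y s = \<tau> s" for s
    unfolding Y_inv_def dom \<tau>_def the_inv_into_def by (rule arg_cong[where f = The]) (auto simp: Y)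
  then have Bbar: "Bbar_fun b g x0 Y (y t) = A_fun a t" if "0 \<le> t" "t < T" for t
    using Bbar_along_solution[OF sol unbdd that] by (simp add: Bbar_fun_def \<tau>_def)
  have "isCont (A_fun a) T" using A_deriv[OF T(2)] by (rule DERIV_isCont)
  then have A_lim: "(A_fun a \<longlongrightarrow> A_fun a T) (at_left T)"
    by (simp add: isCont_def filterlim_at_split)
  have \<tau>: "\<tau> s \<in> {0..<T}" "y (\<tau> s) = s" if "x0 \<le> s" for s
    using bij that unfolding \<tau>_def bij_betw_def
    by (intro the_inv_into_into[OF _ _ order_refl] f_the_inv_into_f; simp)+
  \<comment> \<open>As Bbar at \<open>s\<close> equals A at \<open>\<tau> s\<close> for
    \<open>s\<close> from \<open>x0\<close> on, the limit of Bbar at infinity reduces to the left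
    limit of A at \<open>T\<close>.\<close>
  have \<tau>_lim: "filterlim \<tau> (at_left T) at_top"
    unfolding filterlim_at
  proof
    show "\<forall>\<^sub>F s in at_top. \<tau> s \<in> {..<T} \<and> \<tau> s \<noteq> T"
      using eventually_ge_at_top[of x0] by eventually_elim (use \<tau>(1) in force)
    show "(\<tau> \<longlongrightarrow> T) at_top"
    proof (rule order_tendstoI)
      fix c assume "c < T"
      \<comment> \<open>A lower bound \<open>c\<close> may be negative; raising it to 0 gives a time
        at which \<open>y\<close> can be evaluated.\<close>
      define c' where "c' = max c 0"
      have c': "0 \<le> c'" "c' < T" "c \<le> c'" using \<open>c < T\<close> T(2) by (auto simp: c'_def)
      have "c < \<tau> s" if s: "max x0 (y c') < s" for s
      proof (rule ccontr)
        assume "\<not> c < \<tau> s"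
        then have "y (\<tau> s) \<le> y c'"
          using y_less[OF sol, of "\<tau> s" c'] c' \<tau>(1)[of s] s by (cases "\<tau> s = c'") auto
        then show False using \<tau>(2)[of s] s by auto
      qed
      then show "\<forall>\<^sub>F s in at_top. c < \<tau> s"
        by (rule eventually_mono[OF eventually_gt_at_top])
    next
      fix c assume "T < c"
      then show "\<forall>\<^sub>F s in at_top. \<tau> s < c"
        by (intro eventually_mono[OF eventually_ge_at_top[of x0]]) (use \<tau>(1) in force)
    qed
  qed
  have "(Bbar_fun b g x0 Y \<longlongrightarrow> A_fun a T) at_top"
  proof (rule Lim_transform_eventually)
    show "((\<lambda>s. A_fun a (\<tau> s)) \<longlongrightarrow> A_fun a T) at_top"
      by (rule filterlim_compose[OF A_lim \<tau>_lim])
    show "\<forall>\<^sub>F s in at_top. A_fun a (\<tau> s) = Bbar_fun b g x0 Y s"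
      using eventually_ge_at_top[of x0]
      by eventually_elim (use Bbar[of "\<tau> _"] \<tau> in \<open>metis atLeastLessThan_iff\<close>)
  qed
  then have Bbar_infty: "at_infty (Bbar_fun b g x0 Y) = ereal (A_fun a T)"
    by (intro at_infty_eq) simp
  \<comment> \<open>Strict monotonicity of A makes the description in \<open>A_inv\<close> pick out
    \<open>T\<close>.\<close>
  have "inj_on (\<lambda>t. ereal (A_fun a t)) {0..}"
    using strict_mono_on_imp_inj_on[OF A_strict_mono_on] by (auto simp: inj_on_def)
  then have A_inv: "A_inv a (ereal (A_fun a T)) = T"
    unfolding A_inv_def using T(2) by (auto intro: the_inv_into_f_f)
  have "Sup (ereal ` {0..<T}) = ereal T"
  proof (rule Sup_eqI)
    fix u assume u: "\<And>x. x \<in> ereal ` {0..<T} \<Longrightarrow> x \<le> u"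
    show "ereal T \<le> u"
    proof (rule dense_le_bounded[of "0"])
      show "0 < ereal T" using T(2) by simp
      fix w assume "0 < w" "w < ereal T"
      then show "w \<le> u" using u[of w] by (cases w) auto
    qed
  qed auto
  then have "explosion_time Y = ereal T"
    unfolding explosion_time_def dom .
  then show ?thesis
    using Bbar_infty A_inv T(2) by (auto simp: explodes_in_finite_time_def)
qed

end
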